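(* Let $r>1$ be a rational number, and for $c\in\mathbb{R}$ let $f_c:\mathbb{R}\to\mathbb{R}$, $f_c(x)=|x|^r+c$. Let $(c,n)$ be a periodic pair, i.e. $c\in\mathbb{R}$ and $n\geq 1$ is an integer such that $f_c^n(0)=0$ and $f_c^j(0)\neq 0$ for all integers $j\in[1,n-1]$. Then $c$ is an algebraic integer.
   Context: $f_c^n$ denotes the $n$-fold iterate of $f_c$ (composition with itself $n$ times). *)

theory Defs
  imports Complex_Main "HOL-Computational_Algebra.Computational_Algebra"
begin

(* Note that "0 powr a = 0" for every a, so for positive r this is the usual power also at x = 0. *)
definition f_map :: "rat \<Rightarrow> real \<Rightarrow> real \<Rightarrow> real" where
  "f_map r c x = \<bar>x\<bar> powr of_rat r + c"

definition periodic_pair :: "rat \<Rightarrow> real \<Rightarrow> nat \<Rightarrow> bool" where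
  "periodic_pair r c n \<longleftrightarrow>
     n \<ge> 1 \<and> (f_map r c ^^ n) 0 = 0 \<and> (\<forall>j\<in>{1..<n}. (f_map r c ^^ j) 0 \<noteq> 0)"

end

theory Submission
  imports Defs "Jordan_Normal_Form.Char_Poly"
begin

text \<open>
  The orbit \<open>x\<^sub>1 = c, x\<^sub>2, \<dots>, x\<^sub>n = 0\<close> of the critical point satisfies a system of polynomial
  equations in which the highest powers occur with coefficient 1. Write \<open>r = p / q\<close> with integers
  \<open>p > q > 0\<close> and put \<open>y\<^sub>j = \<bar>x\<^sub>j\<bar>\<close> to the power \<open>1/q\<close>. Then \<open>x\<^sub>j = \<plusminus> y\<^sub>j^q\<close>, and for
  \<open>1 \<le> j < n\<close> the recursion \<open>x\<^bsub>j+1\<^esub> = \<bar>x\<^sub>j\<bar> powr r + c\<close> reads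
  \<open>y\<^sub>j^p = x\<^bsub>j+1\<^esub> - x\<^sub>1\<close>, where the right-hand side is an integer combination of \<open>q\<close>-th powers
  of the \<open>y\<^sub>i\<close> with \<open>1 \<le> i < n\<close>; the periodicity \<open>x\<^sub>n = 0\<close> closes the system.

  Since \<open>q < p\<close>, these relations express every \<open>y\<^sub>j^p\<close> through monomials of smaller total
  degree. Rewriting with them terminates, so the ring \<open>\<int>[y\<^sub>1, \<dots>, y\<^bsub>n-1\<^esub>]\<close> is spanned, as an abelian
  group, by the finitely many monomials with all exponents below \<open>p\<close>
  (\<open>monomial_in_span_reduced\<close>). An element of a ring that is a finitely generated abelian group is
  integral (\<open>algebraic_int_if_stable_span\<close>), and \<open>c = x\<^sub>1\<close> belongs to this ring.
\<close>

section \<open>Integrality from a finitely generated stable group\<close>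

text \<open>
  Integrality is about spans with integer coefficients: \<open>int_module.span S\<close> is the additive
  subgroup generated by \<open>S\<close>.
\<close>

interpretation int_module: Modules.module "\<lambda>(k :: int) (x :: 'a :: comm_ring_1). of_int k * x"
  by unfold_locales (simp_all add: algebra_simps)

lemma algebraic_int_eigenvalue:
  fixes x :: "'a :: field_char_0" and A :: "int mat"
  assumes A: "A \<in> carrier_mat n n" and ev: "eigenvalue (map_mat of_int A) x"
  shows "algebraic_int x"
proof -
  have monic: "lead_coeff (char_poly A) = 1"
    using degree_monic_char_poly[OF A] by auto
  have "poly (char_poly (map_mat of_int A)) x = 0"
    using eigenvalue_root_char_poly[of "map_mat of_int A" n x] A ev by auto
  then have "poly (map_poly of_int (char_poly A)) x = 0"
    using of_int_hom.char_poly_hom[OF A, where ?'a = 'a] by simp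
  with monic show ?thesis
    unfolding algebraic_int_altdef_ipoly by blast
qed

text \<open>
  Multiplication by \<open>x\<close> is described by an integer matrix with respect to the generators \<open>S\<close>, and
  the vector of all generators is an eigenvector of this matrix for the eigenvalue \<open>x\<close>.
\<close>

lemma algebraic_int_if_stable_span:
  fixes x :: "'a :: field_char_0"
  assumes fin: "finite S" and nz: "s \<in> S" "s \<noteq> 0"
    and stable: "\<And>s. s \<in> S \<Longrightarrow> x * s \<in> int_module.span S"
  shows "algebraic_int x"
proof -
  define n where "n = card S"
  obtain b where b: "bij_betw b {0..<n} S"
    using ex_bij_betw_nat_finite[OF fin] unfolding n_def by blast
  have "\<exists>u :: 'a \<Rightarrow> int. x * s = (\<Sum>t\<in>S. of_int (u t) * t)" if "s \<in> S" for s
    using stable[OF that] unfolding int_module.span_finite[OF fin] by auto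
  then obtain u :: "'a \<Rightarrow> 'a \<Rightarrow> int" where u: "\<And>s. s \<in> S \<Longrightarrow> x * s = (\<Sum>t\<in>S. of_int (u s t) * t)"
    by metis
  define A where "A = mat n n (\<lambda>(i, j). u (b i) (b j))"
  have A: "A \<in> carrier_mat n n"
    by (simp add: A_def)
  have row: "(\<Sum>j = 0..<n. of_int (u (b i) (b j)) * b j) = x * b i" if "i < n" for i
    using u[of "b i"] that bij_betwE[OF b]
      sum.reindex_bij_betw[OF b, of "\<lambda>t. of_int (u (b i) t) * t"] by auto
  have "map_mat of_int A *\<^sub>v vec n b = x \<cdot>\<^sub>v vec n b"
    by (rule eq_vecI) (auto simp: A_def scalar_prod_def row)
  moreover obtain i where "i < n" "b i = s"
    using b nz(1) unfolding bij_betw_def by auto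
  then have "vec n b \<noteq> 0\<^sub>v n"
    using nz(2) by (metis index_vec index_zero_vec(1))
  ultimately have "eigenvector (map_mat of_int A) (vec n b) x"
    using A by (auto simp: eigenvector_def)
  then show ?thesis
    using algebraic_int_eigenvalue[OF A] by (auto simp: eigenvalue_def)
qed

section \<open>Rings generated by elements with degree-lowering relations\<close>

lemma span_mult_right:
  fixes x :: "'a :: comm_ring_1"
  assumes "x \<in> int_module.span S" and "\<And>s. s \<in> S \<Longrightarrow> s * b \<in> int_module.span T"
  shows "x * b \<in> int_module.span T"
  using assms(1)
proof (induction rule: int_module.span_induct_alt)
  case base
  then show ?case by (simp add: int_module.span_zero)
next
  case (step k s z)
  have "of_int k * (s * b) + z * b \<in> int_module.span T"
    using step assms(2) by (intro int_module.span_add int_module.span_scale)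
  then show ?case by (simp add: algebra_simps)
qed

definition monomial :: "'i set \<Rightarrow> ('i \<Rightarrow> 'a :: comm_ring_1) \<Rightarrow> ('i \<Rightarrow> nat) \<Rightarrow> 'a" where
  "monomial I y a = (\<Prod>i\<in>I. y i ^ a i)"

lemma monomial_mult: "monomial I y a * monomial I y b = monomial I y (\<lambda>i. a i + b i)"
  by (simp add: monomial_def prod.distrib power_add)

lemma monomial_zero [simp]: "monomial I y (\<lambda>_. 0) = 1"
  by (simp add: monomial_def)

lemma monomial_single:
  assumes "finite I" "j \<in> I"
  shows "monomial I y (\<lambda>i. if i = j then k else 0) = y j ^ k"
proof -
  have "monomial I y (\<lambda>i. if i = j then k else 0) = (\<Prod>i\<in>I. if i = j then y j ^ k else 1)"
    unfolding monomial_def by (rule prod.cong) auto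
  then show ?thesis using assms by simp
qed

abbreviation monomials_below :: "'i set \<Rightarrow> ('i \<Rightarrow> 'a :: comm_ring_1) \<Rightarrow> nat \<Rightarrow> 'a set" where
  "monomials_below I y d \<equiv> {monomial I y a | a. sum a I < d}"

abbreviation reduced_monomials :: "'i set \<Rightarrow> ('i \<Rightarrow> 'a :: comm_ring_1) \<Rightarrow> nat \<Rightarrow> 'a set" where
  "reduced_monomials I y p \<equiv> {monomial I y a | a. \<forall>i\<in>I. a i < p}"

lemma finite_reduced_monomials:
  assumes "finite I"
  shows "finite (reduced_monomials I y p)"
proof -
  have "reduced_monomials I y p \<subseteq> monomial I y ` (PiE I (\<lambda>_. {..<p}))"
  proof
    fix m assume "m \<in> reduced_monomials I y p"
    then obtain a where "m = monomial I y a" "\<forall>i\<in>I. a i < p" by blast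
    then have "m = monomial I y (restrict a I)" "restrict a I \<in> PiE I (\<lambda>_. {..<p})"
      by (auto simp: monomial_def)
    then show "m \<in> monomial I y ` (PiE I (\<lambda>_. {..<p}))" by blast
  qed
  then show ?thesis
    using assms by (meson finite_PiE finite_imageI finite_lessThan finite_subset)
qed

text \<open>
  A monomial that is not reduced contains some factor \<open>y j ^ p\<close>. Replacing this factor by
  monomials of degree less than \<open>p\<close> lowers the total degree, on which the induction runs.
\<close>

lemma monomial_in_span_reduced:
  fixes y :: "'i \<Rightarrow> 'a :: comm_ring_1"
  assumes fin: "finite I"
    and rel: "\<And>j. j \<in> I \<Longrightarrow> y j ^ p \<in> int_module.span (monomials_below I y p)"
  shows "monomial I y a \<in> int_module.span (reduced_monomials I y p)"
proof (induction "sum a I" arbitrary: a rule: less_induct)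
  case less
  show ?case
  proof (cases "\<forall>i\<in>I. a i < p")
    case True
    then show ?thesis by (intro int_module.span_base) blast
  next
    case False
    then obtain j where j: "j \<in> I" "p \<le> a j" by force
    define a' where "a' = a(j := a j - p)"
    have split: "a = (\<lambda>i. (if i = j then p else 0) + a' i)"
      using j by (auto simp: a'_def)
    have deg: "sum a I = p + sum a' I"
      by (subst split) (simp add: sum.distrib fin j)
    have "y j ^ p * monomial I y a' \<in> int_module.span (reduced_monomials I y p)"
    proof (rule span_mult_right[OF rel[OF j(1)]])
      fix m assume "m \<in> monomials_below I y p"
      then obtain b where b: "m = monomial I y b" "sum b I < p" by blast
      then show "m * monomial I y a' \<in> int_module.span (reduced_monomials I y p)"
        using less[of "\<lambda>i. b i + a' i"] deg by (simp add: monomial_mult sum.distrib)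
    qed
    moreover have "y j ^ p * monomial I y a' = monomial I y a"
      by (subst split) (simp add: monomial_mult[symmetric] monomial_single fin j)
    ultimately show ?thesis by simp
  qed
qed

lemma algebraic_int_if_degree_lowering_relations:
  fixes y :: "'i \<Rightarrow> 'a :: field_char_0"
  assumes fin: "finite I" and p: "p > 0"
    and rel: "\<And>j. j \<in> I \<Longrightarrow> y j ^ p \<in> int_module.span (monomials_below I y p)"
    and x: "x \<in> int_module.span (range (monomial I y))"
  shows "algebraic_int x"
proof (rule algebraic_int_if_stable_span)
  show "finite (reduced_monomials I y p)"
    by (rule finite_reduced_monomials[OF fin])
  have "monomial I y (\<lambda>_. 0) \<in> reduced_monomials I y p"
    using p by blast
  then show "1 \<in> reduced_monomials I y p" by simp
  show "x * s \<in> int_module.span (reduced_monomials I y p)" if "s \<in> reduced_monomials I y p" for s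
    using x
  proof (rule span_mult_right)
    fix m assume "m \<in> range (monomial I y)"
    with that show "m * s \<in> int_module.span (reduced_monomials I y p)"
      by (auto simp: monomial_mult intro!: monomial_in_span_reduced[OF fin rel])
  qed
qed simp

section \<open>Periodic critical orbits\<close>

theorem proposition1p3:
  fixes r :: rat and c :: real and n :: nat
  assumes "r > 1"
    and "periodic_pair r c n"
  shows "algebraic_int c"
proof -
  obtain p' q' where "quotient_of r = (p', q')" by force
  then have r': "r = of_int p' / of_int q'" and q': "q' > 0"
    using quotient_of_div quotient_of_denom_pos by blast+
  with \<open>r > 1\<close> have "p' > q'" by (simp add: field_simps)
  define p q where "p = nat p'" and "q = nat q'"
  have q: "0 < q" and qp: "q < p"
    using q' \<open>p' > q'\<close> by (auto simp: p_def q_def)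
  have r: "(of_rat r :: real) = real p / real q"
    using q' \<open>p' > q'\<close> by (simp add: r' of_rat_divide p_def q_def)

  define x where "x j = (f_map r c ^^ j) 0" for j
  have x_Suc: "x (Suc j) = \<bar>x j\<bar> powr (real p / real q) + c" for j
    by (simp add: x_def f_map_def r)
  have x_1: "x 1 = c"
    using x_Suc[of 0] by (simp add: x_def)
  have n: "n \<ge> 1" and x_n: "x n = 0"
    using assms(2) by (auto simp: periodic_pair_def x_def)

  define y where "y j = \<bar>x j\<bar> powr (1 / real q)" for j
  \<comment> \<open>The case \<open>x j = 0\<close> agrees only because \<open>0 powr a = 0\<close>; this is why \<open>k > 0\<close> is needed.\<close>
  have y_power: "y j ^ k = \<bar>x j\<bar> powr (real k / real q)" if "k > 0" for j k
  proof (cases "x j = 0")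
    case False
    then show ?thesis by (simp add: y_def powr_powr flip: powr_realpow)
  qed (use that in \<open>simp add: y_def\<close>)
  define I where "I = {1..<n}"
  define V where "V = int_module.span (monomials_below I y p)"

  \<comment> \<open>\<open>q < p\<close> puts \<open>x j = \<plusminus> y j ^ q\<close> below degree \<open>p\<close>. The last point \<open>x n\<close>, for which \<open>I\<close> has
    no generator, lies in \<open>V\<close> because it vanishes: this is where periodicity enters.\<close>
  have x_in_V: "x j \<in> V" if j: "1 \<le> j" "j \<le> n" for j
  proof (cases "j = n")
    case True
    then show ?thesis by (simp add: x_n V_def int_module.span_zero)
  next
    case False
    with j have "j \<in> I" by (simp add: I_def)
    then have "y j ^ q = monomial I y (\<lambda>i. if i = j then q else 0)"
      by (simp add: monomial_single I_def)
    moreover have "(\<Sum>i\<in>I. if i = j then q else 0) < p"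
      using \<open>j \<in> I\<close> qp by (simp add: I_def)
    ultimately have "y j ^ q \<in> V"
      unfolding V_def by (intro int_module.span_base) blast
    then have "\<bar>x j\<bar> \<in> V"
      using q by (simp add: y_power)
    then have "of_int 1 * \<bar>x j\<bar> \<in> V" "of_int (- 1) * \<bar>x j\<bar> \<in> V"
      unfolding V_def by (intro int_module.span_scale; assumption)+
    then show ?thesis by (cases "x j \<ge> 0") auto
  qed

  show ?thesis
  proof (rule algebraic_int_if_degree_lowering_relations)
    show "finite I" "0 < p" using qp by (auto simp: I_def)
    show "y j ^ p \<in> int_module.span (monomials_below I y p)" if "j \<in> I" for j
    proof -
      have "y j ^ p = x (Suc j) - x 1"
        unfolding x_1 using qp by (simp add: y_power x_Suc)
      also have "\<dots> \<in> V"
        unfolding V_def using that x_in_V n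
        by (intro int_module.span_diff) (auto simp: V_def I_def)
      finally show ?thesis by (simp add: V_def)
    qed
    have "V \<subseteq> int_module.span (range (monomial I y))"
      unfolding V_def by (rule int_module.span_mono) blast
    then show "c \<in> int_module.span (range (monomial I y))"
      using x_in_V[of 1] x_1 n by auto
  qed
qed

end
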